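(* There exists a pseudo-$\mathfrak{c}$-fine precompact abelian group whose pseudocharacter is uncountable.
   Context: All topological groups are Hausdorff. $\mathfrak{c}=2^\omega$ is the cardinality of the continuum. A topological group is precompact if its Weil completion is a compact group. The pseudocharacter $\psi(G)$ of a topological group $G$ is the least cardinal $\kappa$ such that there is a family of $\kappa$ open neighbourhoods of the identity $1_G$ whose intersection is $\{1_G\}$. For an infinite cardinal $\tau$, a topological group $G$ is pseudo-$\tau$-fine if for every family $\{U_\alpha:\alpha\in\tau\}$ of identity neighbourhoods there is a countable family $\{V_n:n\in\omega\}$ of identity neighbourhoods with $\bigcap_{n\in\omega}V_n\subseteq\bigcap_{\alpha\in\tau}U_\alpha$. *)

theory Defs
  imports "HOL-Analysis.Analysis" "HOL-Algebra.Group"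
begin

unbundle cardinal_syntax

text \<open>All topological groups are Hausdorff; this is part of the definition.\<close>

definition topological_group :: "('a, 'm) monoid_scheme \<Rightarrow> 'a topology \<Rightarrow> bool" where
  "topological_group G T \<longleftrightarrow>
     group G \<and> topspace T = carrier G \<and> Hausdorff_space T \<and>
     continuous_map (prod_topology T T) T (\<lambda>(x, y). x \<otimes>\<^bsub>G\<^esub> y) \<and>
     continuous_map T T (\<lambda>x. inv\<^bsub>G\<^esub> x)"

definition identity_nbhd :: "('a, 'm) monoid_scheme \<Rightarrow> 'a topology \<Rightarrow> 'a set \<Rightarrow> bool" where
  "identity_nbhd G T U \<longleftrightarrow>
     U \<subseteq> carrier G \<and> (\<exists>W. openin T W \<and> \<one>\<^bsub>G\<^esub> \<in> W \<and> W \<subseteq> U)"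

text \<open>Cauchy filters are those of the left uniformity, whose entourages are
  the sets of all \<open>(x, y)\<close> with \<open>x\<inverse>y \<in> U\<close>, for \<open>U\<close> an identity neighbourhood.\<close>

definition left_cauchy_filter :: "('a, 'm) monoid_scheme \<Rightarrow> 'a topology \<Rightarrow> 'a filter \<Rightarrow> bool" where
  "left_cauchy_filter G T F \<longleftrightarrow>
     F \<noteq> bot \<and> F \<le> principal (carrier G) \<and>
     (\<forall>U. identity_nbhd G T U \<longrightarrow>
        (\<exists>A. eventually (\<lambda>x. x \<in> A) F \<and> A \<subseteq> carrier G \<and>
             (\<forall>x\<in>A. \<forall>y\<in>A. inv\<^bsub>G\<^esub> x \<otimes>\<^bsub>G\<^esub> y \<in> U)))"

definition Weil_complete :: "('a, 'm) monoid_scheme \<Rightarrow> 'a topology \<Rightarrow> bool" where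
  "Weil_complete G T \<longleftrightarrow>
     (\<forall>F. left_cauchy_filter G T F \<longrightarrow> (\<exists>l. limitin T (\<lambda>x. x) l F))"

definition Weil_completion ::
  "('a, 'm) monoid_scheme \<Rightarrow> 'a topology \<Rightarrow> ('b, 'n) monoid_scheme \<Rightarrow> 'b topology \<Rightarrow> ('a \<Rightarrow> 'b) \<Rightarrow> bool"
where
  "Weil_completion G T H S e \<longleftrightarrow>
     topological_group H S \<and> Weil_complete H S \<and>
     e \<in> hom G H \<and> embedding_map T S e \<and> S closure_of (e ` carrier G) = carrier H"

text \<open>The Weil completion is unique up to topological isomorphism over \<open>G\<close>, so
  being compact does not depend on which one is chosen. The type \<open>'a set set\<close> is
  large enough to carry it: a point of a Hausdorff space is determined by
  the traces of its neighbourhoods on a dense subset.\<close>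

definition precompact_group :: "('a, 'm) monoid_scheme \<Rightarrow> 'a topology \<Rightarrow> bool" where
  "precompact_group G T \<longleftrightarrow>
     topological_group G T \<and>
     (\<exists>(H :: 'a set set monoid) S e. Weil_completion G T H S e \<and> compact_space S)"

text \<open>Cardinals are represented as in the library, by cardinal orders, and
  \<open>\<alpha> \<in> \<kappa>\<close> is \<open>\<alpha> \<in> Field \<kappa>\<close>. The intersection is taken inside \<open>G\<close>.\<close>

definition identity_pseudobase ::
  "('a, 'm) monoid_scheme \<Rightarrow> 'a topology \<Rightarrow> 'i rel \<Rightarrow> ('i \<Rightarrow> 'a set) \<Rightarrow> bool" where
  "identity_pseudobase G T \<kappa> U \<longleftrightarrow>
     (\<forall>\<alpha>\<in>Field \<kappa>. openin T (U \<alpha>) \<and> \<one>\<^bsub>G\<^esub> \<in> U \<alpha>) \<and>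
     carrier G \<inter> (\<Inter>\<alpha>\<in>Field \<kappa>. U \<alpha>) = {\<one>\<^bsub>G\<^esub>}"

text \<open>Families of subsets of \<open>G\<close> never need more indices than there are
  subsets, so it suffices to look for the least cardinal on the type \<open>'a set\<close>; the lemma
  \<open>pseudocharacter_least\<close> compares it with cardinals on arbitrary types.\<close>

definition pseudocharacter :: "('a, 'm) monoid_scheme \<Rightarrow> 'a topology \<Rightarrow> 'a set rel" where
  "pseudocharacter G T =
     (SOME \<kappa>. Card_order \<kappa> \<and> (\<exists>U. identity_pseudobase G T \<kappa> U) \<and>
        (\<forall>\<kappa>' :: 'a set rel. Card_order \<kappa>' \<and> (\<exists>U. identity_pseudobase G T \<kappa>' U) \<longrightarrow> \<kappa> \<le>o \<kappa>'))"

text \<open>The notion is meant for infinite \<open>\<tau>\<close>.\<close>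

definition pseudo_fine :: "'i rel \<Rightarrow> ('a, 'm) monoid_scheme \<Rightarrow> 'a topology \<Rightarrow> bool" where
  "pseudo_fine \<tau> G T \<longleftrightarrow>
     (\<forall>U :: 'i \<Rightarrow> 'a set. (\<forall>\<alpha>\<in>Field \<tau>. identity_nbhd G T (U \<alpha>)) \<longrightarrow>
        (\<exists>V :: nat \<Rightarrow> 'a set. (\<forall>n. identity_nbhd G T (V n)) \<and>
            (\<Inter>n. V n) \<subseteq> (\<Inter>\<alpha>\<in>Field \<tau>. U \<alpha>)))"

definition continuum :: "(nat \<Rightarrow> bool) rel" where
  "continuum = ctwo ^c natLeq"

lemma identity_pseudobase_exists:
  fixes G :: "('a, 'm) monoid_scheme"
  assumes "topological_group G T"
  shows "\<exists>(\<kappa> :: 'a set rel) U. Card_order \<kappa> \<and> identity_pseudobase G T \<kappa> U"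
proof -
  interpret group G using assms by (simp add: topological_group_def)
  have T: "topspace T = carrier G" "Hausdorff_space T"
    using assms by (auto simp: topological_group_def)
  let ?N = "{U. openin T U \<and> \<one>\<^bsub>G\<^esub> \<in> U}"
  have "x = \<one>\<^bsub>G\<^esub>" if x: "x \<in> carrier G" "\<forall>U\<in>?N. x \<in> U" for x
  proof (rule ccontr)
    assume "x \<noteq> \<one>\<^bsub>G\<^esub>"
    then obtain U V where "openin T U" "openin T V" "\<one>\<^bsub>G\<^esub> \<in> U" "x \<in> V" "disjnt U V"
      using T x(1) one_closed unfolding Hausdorff_space_def by metis
    then show False using x by (auto simp: disjnt_def)
  qed
  then have "identity_pseudobase G T |?N| (\<lambda>U. U)"
    by (auto simp: identity_pseudobase_def Field_card_of)
  then show ?thesis using card_of_Card_order by blast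
qed

lemma pseudocharacter_attained:
  fixes G :: "('a, 'm) monoid_scheme"
  assumes "topological_group G T"
  shows "Card_order (pseudocharacter G T)"
    and "\<exists>U. identity_pseudobase G T (pseudocharacter G T) U"
    and "\<And>\<kappa> :: 'a set rel. \<lbrakk>Card_order \<kappa>; identity_pseudobase G T \<kappa> U\<rbrakk> \<Longrightarrow> pseudocharacter G T \<le>o \<kappa>"
proof -
  let ?R = "{\<kappa> :: 'a set rel. Card_order \<kappa> \<and> (\<exists>U. identity_pseudobase G T \<kappa> U)}"
  have "\<exists>r\<in>?R. \<forall>r'\<in>?R. r \<le>o r'"
    using identity_pseudobase_exists[OF assms] by (intro exists_minim_Card_order) auto
  then have "\<exists>\<kappa> :: 'a set rel. Card_order \<kappa> \<and> (\<exists>U. identity_pseudobase G T \<kappa> U) \<and>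
      (\<forall>\<kappa>' :: 'a set rel. Card_order \<kappa>' \<and> (\<exists>U. identity_pseudobase G T \<kappa>' U) \<longrightarrow> \<kappa> \<le>o \<kappa>')"
    by blast
  from someI_ex[OF this, folded pseudocharacter_def]
  show "Card_order (pseudocharacter G T)"
    and "\<exists>U. identity_pseudobase G T (pseudocharacter G T) U"
    and "\<And>\<kappa> :: 'a set rel. \<lbrakk>Card_order \<kappa>; identity_pseudobase G T \<kappa> U\<rbrakk> \<Longrightarrow> pseudocharacter G T \<le>o \<kappa>"
    by blast+
qed

lemma pseudocharacter_least:
  fixes \<kappa> :: "'i rel"
  assumes "topological_group G T" "Card_order \<kappa>" "identity_pseudobase G T \<kappa> U"
  shows "pseudocharacter G T \<le>o \<kappa>"
proof -
  have "identity_pseudobase G T |U ` Field \<kappa>| (\<lambda>V. V)"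
    using assms(3) by (auto simp: identity_pseudobase_def Field_card_of)
  then have "pseudocharacter G T \<le>o |U ` Field \<kappa>|"
    using pseudocharacter_attained(3)[OF assms(1)] card_of_Card_order by blast
  also have "|U ` Field \<kappa>| \<le>o |Field \<kappa>|" by (rule card_of_image)
  also have "|Field \<kappa>| =o \<kappa>" using assms(2) by (rule card_of_Field_ordIso)
  finally show ?thesis .
qed

end

theory Submission
  imports Defs
begin

text \<open>Let \<open>\<kappa>\<close> be the successor cardinal of the continuum and let \<open>G\<close> be the Boolean group of the
  finite subsets of \<open>\<kappa>\<close>. For \<open>a < \<kappa>\<close> let \<open>G\<^sub>a\<close> be the subgroup of those sets that contain nothing
  below \<open>a\<close>. As \<open>a\<close> embeds into the reals, \<open>G\<^sub>a\<close> is the intersection of countably many kernels of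
  characters: count modulo 2 the points below \<open>a\<close> that are mapped below a given rational. The
  topology induced by all these characters embeds \<open>G\<close> into a power of the two-element group, so it
  is precompact. By regularity of \<open>\<kappa>\<close>, an intersection of at most continuum many identity
  neighbourhoods contains some \<open>G\<^sub>a\<close>, which is a nontrivial countable intersection of identity
  neighbourhoods.\<close>

section \<open>Topological groups, compactness and completions\<close>

lemma topological_groupD:
  assumes "topological_group G T"
  shows "group G" "topspace T = carrier G" "Hausdorff_space T"
    "continuous_map (prod_topology T T) T (\<lambda>(x, y). x \<otimes>\<^bsub>G\<^esub> y)"
    "continuous_map T T (\<lambda>x. inv\<^bsub>G\<^esub> x)"
  using assms by (auto simp: topological_group_def)

text \<open>Since \<open>e\<close> is a homomorphism, the operations of \<open>G\<close> followed by
  \<open>e\<close> are the operations of \<open>K\<close> preceded by \<open>e\<close>, hence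
  continuous into \<open>S\<close>. Injectivity of \<open>e\<close> lets separating open sets be
  pulled back.\<close>

lemma topological_group_pullback:
  assumes K: "topological_group K S" and G: "group G"
    and e: "e \<in> hom G K" and inj: "inj_on e (carrier G)"
  shows "topological_group G (pullback_topology (carrier G) e S)"
proof -
  let ?T = "pullback_topology (carrier G) e S"
  note K = topological_groupD[OF K]
  interpret group_hom G K e
    using G K(1) e by (simp add: group_hom_def group_hom_axioms_def)
  have top: "topspace ?T = carrier G"
    using e K(2) by (auto simp: topspace_pullback_topology hom_def)
  have cont: "continuous_map ?T S e"
    using continuous_map_pullback[OF continuous_map_id, of "carrier G" e S] by simp
  have into: "continuous_map Z ?T f"
    if "continuous_map Z S (e \<circ> f)" "f \<in> topspace Z \<rightarrow> carrier G" for Z :: "'z topology" and f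
    using that by (intro continuous_map_pullback') auto
  have "continuous_map ?T S (\<lambda>x. inv\<^bsub>K\<^esub> e x)"
    using continuous_map_compose[OF cont K(5)] by (simp add: o_def)
  then have inv: "continuous_map ?T ?T (\<lambda>x. inv\<^bsub>G\<^esub> x)"
    by (intro into) (auto simp: top hom_inv elim!: continuous_map_eq)
  have "continuous_map (prod_topology ?T ?T) S (\<lambda>z. e (fst z) \<otimes>\<^bsub>K\<^esub> e (snd z))"
    using continuous_map_compose[OF _ K(4),
        of "prod_topology ?T ?T" "\<lambda>z. (e (fst z), e (snd z))"]
      continuous_map_compose[OF continuous_map_fst cont]
      continuous_map_compose[OF continuous_map_snd cont]
    by (auto simp: o_def continuous_map_pairwise)
  then have mult: "continuous_map (prod_topology ?T ?T) ?T (\<lambda>(x, y). x \<otimes>\<^bsub>G\<^esub> y)"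
    by (intro into) (auto simp: top hom_mult elim!: continuous_map_eq)
  have "Hausdorff_space ?T"
    unfolding Hausdorff_space_def
  proof (intro allI impI)
    fix x y assume xy: "x \<in> topspace ?T \<and> y \<in> topspace ?T \<and> x \<noteq> y"
    then have "e x \<noteq> e y" "e x \<in> topspace S" "e y \<in> topspace S"
      using inj top K(2) by (auto dest: inj_onD)
    then obtain U V where "openin S U" "openin S V" "e x \<in> U" "e y \<in> V" "disjnt U V"
      using K(3) unfolding Hausdorff_space_def by metis
    then show "\<exists>U V. openin ?T U \<and> openin ?T V \<and> x \<in> U \<and> y \<in> V \<and> disjnt U V"
      using xy top
      by (intro exI[of _ "e -` U \<inter> carrier G"] exI[of _ "e -` V \<inter> carrier G"])
        (auto simp: openin_pullback_topology disjnt_def)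
  qed
  with inv mult show ?thesis
    using G top by (simp add: topological_group_def)
qed

lemma topological_group_subgroup:
  assumes K: "topological_group K S" and C: "subgroup C K"
  shows "topological_group (K\<lparr>carrier := C\<rparr>) (subtopology S C)"
proof -
  interpret group K using K by (rule topological_groupD)
  have "C \<subseteq> carrier K" using C by (rule subgroup.subset)
  then have "pullback_topology C (\<lambda>x. x) S = subtopology S C"
    by (auto simp: topology_eq openin_pullback_topology openin_subtopology)
  moreover have "(\<lambda>x. x) \<in> hom (K\<lparr>carrier := C\<rparr>) K"
    using \<open>C \<subseteq> carrier K\<close> by (auto simp: hom_def)
  ultimately show ?thesis
    using topological_group_pullback[OF K subgroup_imp_group[OF C], of "\<lambda>x. x"]
    by (simp add: inj_on_def)
qed

text \<open>Continuous operations that preserve \<open>C\<close> preserve its closure. For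
  multiplication this uses that the closure of a product is the product of the closures.\<close>

lemma subgroup_closure_of:
  assumes K: "topological_group K S" and C: "subgroup C K"
  shows "subgroup (S closure_of C) K"
proof -
  note K = topological_groupD[OF K]
  interpret group K by (rule K)
  interpret C: subgroup C K by (rule C)
  have "C \<subseteq> S closure_of C"
    using C.subset K(2) by (simp add: closure_of_subset)
  moreover have "inv\<^bsub>K\<^esub> x \<in> S closure_of C" if "x \<in> S closure_of C" for x
  proof -
    have "(\<lambda>x. inv\<^bsub>K\<^esub> x) ` C \<subseteq> C" by auto
    then show ?thesis
      using continuous_map_image_closure_subset[OF K(5), of C] that
        closure_of_mono[of "(\<lambda>x. inv\<^bsub>K\<^esub> x) ` C" C S] by blast
  qed
  moreover have "x \<otimes>\<^bsub>K\<^esub> y \<in> S closure_of C"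
    if "x \<in> S closure_of C" "y \<in> S closure_of C" for x y
  proof -
    have "(\<lambda>(x, y). x \<otimes>\<^bsub>K\<^esub> y) ` (C \<times> C) \<subseteq> C" by auto
    moreover have "(x, y) \<in> prod_topology S S closure_of (C \<times> C)"
      using that by (simp add: closure_of_Times)
    ultimately show ?thesis
      using continuous_map_image_closure_subset[OF K(4), of "C \<times> C"]
        closure_of_mono[of "(\<lambda>(x, y). x \<otimes>\<^bsub>K\<^esub> y) ` (C \<times> C)" C S] by blast
  qed
  ultimately show ?thesis
    using closure_of_subset_topspace[of S C] K(2) by unfold_locales auto
qed

text \<open>By compactness the closures of the members of a Cauchy filter have a common point, and a
  Cauchy filter converges to each of its cluster points.\<close>

lemma compact_imp_Weil_complete:
  assumes K: "topological_group K S" and S: "compact_space S"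
  shows "Weil_complete K S"
  unfolding Weil_complete_def
proof (intro allI impI)
  note K = topological_groupD[OF K]
  interpret group K by (rule K)
  fix F assume F: "left_cauchy_filter K S F"
  let ?\<A> = "{A. A \<subseteq> carrier K \<and> (\<forall>\<^sub>F x in F. x \<in> A)}"
  let ?\<U> = "(\<lambda>A. S closure_of A) ` ?\<A>"
  have carr: "\<forall>\<^sub>F x in F. x \<in> carrier K" and "F \<noteq> bot"
    using F by (auto simp: left_cauchy_filter_def le_principal)
  have "\<Inter>\<F> \<noteq> {}" if "finite \<F>" "\<F> \<subseteq> ?\<U>" for \<F>
  proof -
    from finite_subset_image[OF that]
    obtain \<B> where \<B>: "\<B> \<subseteq> ?\<A>" "finite \<B>" "\<F> = (\<lambda>A. S closure_of A) ` \<B>"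
      by blast
    have "\<forall>\<^sub>F x in F. \<forall>A\<in>\<B>. x \<in> A"
      using \<B> by (intro eventually_ball_finite) auto
    from eventually_happens'[OF \<open>F \<noteq> bot\<close> eventually_conj[OF carr this]]
    obtain x where "x \<in> carrier K" "\<forall>A\<in>\<B>. x \<in> A"
      by blast
    moreover have "A \<subseteq> S closure_of A" if "A \<in> \<B>" for A
      using that \<B>(1) K(2) by (intro closure_of_subset) auto
    ultimately have "x \<in> \<Inter>\<F>"
      unfolding \<B>(3) by blast
    then show ?thesis by blast
  qed
  moreover have "\<forall>C\<in>?\<U>. closedin S C" by auto
  ultimately have "\<Inter>?\<U> \<noteq> {}"
    using S unfolding compact_space_fip by meson
  then obtain x where x: "\<And>A. A \<in> ?\<A> \<Longrightarrow> x \<in> S closure_of A" by blast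
  have xS: "x \<in> topspace S"
    using x[of "carrier K"] carr closure_of_subset_topspace by fast
  have "\<forall>\<^sub>F y in F. y \<in> W" if W: "openin S W" "x \<in> W" for W
  proof -
    \<comment> \<open>Continuity of multiplication at \<open>(x, \<one>)\<close> gives
      \<open>N\<close> and \<open>V\<close> whose product lies in \<open>W\<close>. A member
      \<open>A\<close> of the filter that is small with respect to \<open>V\<close> meets
      \<open>N\<close> in some \<open>a\<close>, and then each \<open>b\<close> in \<open>A\<close>
      is the product of \<open>a\<close> in \<open>N\<close> and of \<open>a\<close>-inverse times
      \<open>b\<close> in \<open>V\<close>.\<close>
    let ?P = "{z \<in> topspace (prod_topology S S). (\<lambda>(x, y). x \<otimes>\<^bsub>K\<^esub> y) z \<in> W}"
    have "openin (prod_topology S S) ?P" "(x, \<one>\<^bsub>K\<^esub>) \<in> ?P"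
      using openin_continuous_map_preimage[OF K(4) W(1)] xS K(2) W(2) by auto
    then obtain N V where NV: "openin S N" "openin S V" "x \<in> N" "\<one>\<^bsub>K\<^esub> \<in> V" "N \<times> V \<subseteq> ?P"
      unfolding openin_prod_topology_alt by meson
    have "identity_nbhd K S V"
      using NV openin_subset[OF NV(2)] K(2) by (auto simp: identity_nbhd_def)
    then obtain A where A: "\<forall>\<^sub>F x in F. x \<in> A" "A \<subseteq> carrier K"
        "\<And>a b. a \<in> A \<Longrightarrow> b \<in> A \<Longrightarrow> inv\<^bsub>K\<^esub> a \<otimes>\<^bsub>K\<^esub> b \<in> V"
      using F unfolding left_cauchy_filter_def by meson
    obtain a where a: "a \<in> A" "a \<in> N"
      using x[of A] A NV(1,3) unfolding in_closure_of by blast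
    have "b \<in> W" if "b \<in> A" for b
    proof -
      have "a \<otimes>\<^bsub>K\<^esub> (inv\<^bsub>K\<^esub> a \<otimes>\<^bsub>K\<^esub> b) \<in> W"
        using NV(5) A(3)[OF a(1) that] a(2) by auto
      then show ?thesis
        using a(1) that A(2) by (auto simp: m_assoc[symmetric] subset_iff)
    qed
    then show ?thesis using A(1) by (auto elim: eventually_mono)
  qed
  then show "\<exists>l. limitin S (\<lambda>x. x) l F"
    using xS by (auto simp: limitin_def)
qed

text \<open>The closure of the image of \<open>G\<close> in the compact group \<open>K\<close> is a
  compact, hence complete, group in which \<open>G\<close> is dense; so it serves as the Weil
  completion. The elements of \<open>K\<close> have the type that \<open>precompact_group\<close>
  prescribes for completions.\<close>

lemma precompact_group_pullback:
  fixes G :: "('a, 'm) monoid_scheme" and K :: "'a set set monoid"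
  assumes K: "topological_group K S" and S: "compact_space S" and G: "group G"
    and e: "e \<in> hom G K" and inj: "inj_on e (carrier G)"
  shows "precompact_group G (pullback_topology (carrier G) e S)"
proof -
  let ?T = "pullback_topology (carrier G) e S"
  let ?C = "S closure_of (e ` carrier G)"
  let ?H = "K\<lparr>carrier := ?C\<rparr>" and ?S = "subtopology S ?C"
  note top = topological_groupD(2)[OF K]
  interpret group_hom G K e
    by (intro group_hom.intro group_hom_axioms.intro G e topological_groupD(1)[OF K])
  have sub: "e ` carrier G \<subseteq> ?C"
    by (rule closure_of_subset) (use top hom_closed in blast)
  have H: "topological_group ?H ?S"
    using topological_group_subgroup[OF K subgroup_closure_of[OF K img_is_subgroup]] .
  have compact: "compact_space ?S"
    using S by (simp add: closedin_compact_space compact_space_subtopology)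
  have "homeomorphic_map ?T (subtopology S (e ` carrier G)) e"
  proof (rule bijective_open_imp_homeomorphic_map)
    have topT: "topspace ?T = carrier G"
      using top by (auto simp: topspace_pullback_topology)
    show "continuous_map ?T (subtopology S (e ` carrier G)) e"
      using continuous_map_pullback[OF continuous_map_id, of "carrier G" e S] topT
      by (auto simp: continuous_map_in_subtopology)
    show "open_map ?T (subtopology S (e ` carrier G)) e"
      by (auto simp: open_map_def openin_pullback_topology openin_subtopology)
    show "e ` topspace ?T = topspace (subtopology S (e ` carrier G))" "inj_on e (topspace ?T)"
      using topT top inj by auto
  qed
  moreover have "topspace ?T = carrier G"
    using top by (auto simp: topspace_pullback_topology)
  ultimately have "embedding_map ?T ?S e"
    using sub by (simp add: embedding_map_def subtopology_subtopology Int_absorb1)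
  moreover have "e \<in> hom G ?H"
    using sub by (auto simp: hom_def)
  moreover have "?S closure_of (e ` carrier G) = carrier ?H"
    using sub by (simp add: closure_of_subtopology Int_absorb1)
  ultimately have "Weil_completion G ?T ?H ?S e"
    using H compact_imp_Weil_complete[OF H compact] by (simp add: Weil_completion_def)
  with compact show ?thesis
    unfolding precompact_group_def using topological_group_pullback[OF K G e inj] by blast
qed


section \<open>Boolean groups of sets and the Cantor cube\<close>

definition sym_diff_group :: "'a set set \<Rightarrow> 'a set monoid" where
  "sym_diff_group \<C> = \<lparr>carrier = \<C>, mult = sym_diff, one = {}\<rparr>"

lemma sym_diff_group_simps [simp]:
  "carrier (sym_diff_group \<C>) = \<C>"
  "X \<otimes>\<^bsub>sym_diff_group \<C>\<^esub> Y = sym_diff X Y"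
  "\<one>\<^bsub>sym_diff_group \<C>\<^esub> = {}"
  by (simp_all add: sym_diff_group_def)

lemma comm_group_sym_diff_group:
  assumes "{} \<in> \<C>" and "\<And>X Y. X \<in> \<C> \<Longrightarrow> Y \<in> \<C> \<Longrightarrow> sym_diff X Y \<in> \<C>"
  shows "comm_group (sym_diff_group \<C>)"
proof (rule comm_groupI)
  fix X assume "X \<in> carrier (sym_diff_group \<C>)"
  then show "\<exists>Y\<in>carrier (sym_diff_group \<C>).
      Y \<otimes>\<^bsub>sym_diff_group \<C>\<^esub> X = \<one>\<^bsub>sym_diff_group \<C>\<^esub>"
    by (intro bexI[of _ X]) auto
qed (use assms in auto)

lemma even_card_sym_diff:
  assumes "finite X" "finite Y"
  shows "even (card (sym_diff X Y)) \<longleftrightarrow> (even (card X) \<longleftrightarrow> even (card Y))"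
proof -
  have "card (sym_diff X Y) = card (X - Y) + card (Y - X)"
    using assms by (intro card_Un_disjoint) auto
  moreover have "card X = card (X - Y) + card (X \<inter> Y)" "card Y = card (Y - X) + card (X \<inter> Y)"
    using assms by (subst card_Un_disjoint[symmetric]; fastforce intro: arg_cong[of _ _ card])+
  ultimately show ?thesis by presburger
qed

text \<open>The Cantor cube, with points written as sets instead of characteristic functions. With
  sets of type \<open>'a set\<close> as coordinates, its points have the type
  \<open>'a set set\<close> of the completions in \<open>precompact_group\<close>.\<close>

definition powerset_topology :: "'a set topology" where
  "powerset_topology =
     pullback_topology UNIV (\<lambda>X i. i \<in> X) (product_topology (\<lambda>_. discrete_topology UNIV) UNIV)"

lemma topspace_powerset_topology [simp]: "topspace powerset_topology = UNIV"
  by (simp add: powerset_topology_def topspace_pullback_topology)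

lemma continuous_map_powerset_mem:
  "continuous_map powerset_topology (discrete_topology UNIV) (\<lambda>X. i \<in> X)"
proof -
  have "continuous_map (product_topology (\<lambda>_. discrete_topology UNIV) UNIV)
      (discrete_topology UNIV) (\<lambda>f :: 'a \<Rightarrow> bool. f i)"
    by (intro continuous_map_product_projection) simp
  from continuous_map_pullback[OF this] show ?thesis
    by (simp add: powerset_topology_def o_def)
qed

lemma continuous_map_into_powerset:
  assumes "\<And>i. continuous_map Z (discrete_topology UNIV) (\<lambda>z. i \<in> f z)"
  shows "continuous_map Z powerset_topology f"
  unfolding powerset_topology_def
  using assms by (intro continuous_map_pullback') (simp_all add: continuous_map_componentwise_UNIV o_def)

lemma openin_powerset_mem:
  "openin powerset_topology {X. i \<in> X}" "openin powerset_topology {X. i \<notin> X}"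
  using openin_continuous_map_preimage[OF continuous_map_powerset_mem[of i], of "{True}"]
    openin_continuous_map_preimage[OF continuous_map_powerset_mem[of i], of "{False}"]
  by simp_all

text \<open>A basic open box of the product restricts only finitely many coordinates; these form
  \<open>A\<close>.\<close>

lemma openin_powerset_finite:
  assumes "openin powerset_topology W" "X \<in> W"
  obtains A where "finite A" "\<And>Y. Y \<inter> A = X \<inter> A \<Longrightarrow> Y \<in> W"
proof -
  obtain U where U: "openin (product_topology (\<lambda>_. discrete_topology UNIV) UNIV) U"
    and W: "W = (\<lambda>X i. i \<in> X) -` U"
    using assms(1) by (auto simp: powerset_topology_def openin_pullback_topology)
  then obtain N where N: "(\<lambda>i. i \<in> X) \<in> Pi\<^sub>E UNIV N" "finite {i. N i \<noteq> UNIV}" "Pi\<^sub>E UNIV N \<subseteq> U"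
    using product_topology_open_contains_basis[OF U, of "\<lambda>i. i \<in> X"] assms(2) by auto
  show thesis
  proof (rule that[OF N(2)])
    fix Y assume eq: "Y \<inter> {i. N i \<noteq> UNIV} = X \<inter> {i. N i \<noteq> UNIV}"
    have "(i \<in> Y) \<in> N i" for i
    proof (cases "N i = UNIV")
      case False
      then have "i \<in> Y \<longleftrightarrow> i \<in> X" using eq by blast
      then show ?thesis using N(1) by (simp add: PiE_iff)
    qed auto
    then show "Y \<in> W" using N(3) W by (auto simp: PiE_iff)
  qed
qed

text \<open>Tychonoff's theorem, carried over from the product by the continuous surjection that
  turns characteristic functions into sets.\<close>

lemma compact_space_powerset: "compact_space powerset_topology"
proof -
  let ?P = "product_topology (\<lambda>_ :: 'a. discrete_topology (UNIV :: bool set)) UNIV"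
  have "continuous_map ?P powerset_topology (\<lambda>f. {i. f i})"
  proof (rule continuous_map_into_powerset)
    fix i :: 'a
    show "continuous_map ?P (discrete_topology UNIV) (\<lambda>f. i \<in> {i. f i})"
      unfolding mem_Collect_eq by (rule continuous_map_product_projection) simp
  qed
  moreover have "compact_space ?P"
    by (simp add: compact_space_product_topology compact_space_discrete_topology)
  moreover have "range (\<lambda>f :: 'a \<Rightarrow> bool. {i. f i}) = UNIV"
    by (rule surjI[where f = "\<lambda>X i. i \<in> X"]) simp
  ultimately show ?thesis
    using image_compactin[of ?P "topspace ?P" powerset_topology "\<lambda>f. {i. f i}"]
    by (simp add: compact_space_def)
qed

lemma topological_group_powerset:
  "topological_group (sym_diff_group (UNIV :: 'a set set)) powerset_topology"
proof -
  let ?K = "sym_diff_group (UNIV :: 'a set set)"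
  interpret comm_group ?K by (rule comm_group_sym_diff_group) auto
  have inv: "inv\<^bsub>?K\<^esub> X = X" for X
    by (rule inv_equality) auto
  have "continuous_map (prod_topology powerset_topology powerset_topology)
      (discrete_topology UNIV) (\<lambda>z. i \<in> sym_diff (fst z) (snd z))" for i :: 'a
  proof -
    have mem: "continuous_map (prod_topology powerset_topology powerset_topology)
        (discrete_topology UNIV) (\<lambda>z. i \<in> fst z)"
      "continuous_map (prod_topology powerset_topology powerset_topology)
        (discrete_topology UNIV) (\<lambda>z. i \<in> snd z)"
      using continuous_map_compose[OF continuous_map_fst continuous_map_powerset_mem]
        continuous_map_compose[OF continuous_map_snd continuous_map_powerset_mem]
      by (simp_all add: o_def)
    \<comment> \<open>Membership in a symmetric difference is the exclusive or of two memberships,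
      and every map between discrete spaces is continuous.\<close>
    have "continuous_map (prod_topology powerset_topology powerset_topology)
        (discrete_topology (UNIV \<times> UNIV)) (\<lambda>z. (i \<in> fst z, i \<in> snd z))"
      using mem by (simp only: prod_topology_discrete_topology continuous_map_pairwise o_def fst_conv snd_conv)
    moreover have "continuous_map (discrete_topology (UNIV \<times> UNIV)) (discrete_topology UNIV)
        (\<lambda>(p :: bool, q). p \<noteq> q)"
      by simp
    ultimately have "continuous_map (prod_topology powerset_topology powerset_topology)
        (discrete_topology UNIV) ((\<lambda>(p, q). p \<noteq> q) \<circ> (\<lambda>z. (i \<in> fst z, i \<in> snd z)))"
      by (rule continuous_map_compose)
    then show ?thesis
      by (rule continuous_map_eq) auto
  qed
  then have "continuous_map (prod_topology powerset_topology powerset_topology) powerset_topology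
      (\<lambda>z :: 'a set \<times> 'a set. sym_diff (fst z) (snd z))"
    by (rule continuous_map_into_powerset)
  moreover have "Hausdorff_space (powerset_topology :: 'a set topology)"
    unfolding Hausdorff_space_def
  proof (intro allI impI)
    fix X Y :: "'a set"
    assume "X \<in> topspace powerset_topology \<and> Y \<in> topspace powerset_topology \<and> X \<noteq> Y"
    then obtain i where "i \<in> X \<longleftrightarrow> i \<notin> Y" by auto
    then show "\<exists>U V. openin powerset_topology U \<and> openin powerset_topology V \<and>
        X \<in> U \<and> Y \<in> V \<and> disjnt U V"
      using openin_powerset_mem[of i]
      by (cases "i \<in> X")
        (rule exI[of _ "{X. i \<in> X}"], rule exI[of _ "{X. i \<notin> X}"], simp add: disjnt_iff,
         rule exI[of _ "{X. i \<notin> X}"], rule exI[of _ "{X. i \<in> X}"], simp add: disjnt_iff)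
  qed
  ultimately show ?thesis
    using is_group by (simp add: topological_group_def inv case_prod_unfold)
qed


section \<open>Group topologies generated by kernels of index at most two\<close>

text \<open>A subset \<open>K\<close> of a group \<open>G\<close> satisfying the hypothesis \<open>index\<close> below is a subgroup of index
  at most two, that is, the kernel of a character with values in a group of order two. The value at
  \<open>x\<close> of this character is recorded by \<open>x \<notin> K\<close>.\<close>

definition kernel_topology :: "('a, 'm) monoid_scheme \<Rightarrow> 'a set set \<Rightarrow> 'a topology" where
  "kernel_topology G \<K> = pullback_topology (carrier G) (\<lambda>x. {K \<in> \<K>. x \<notin> K}) powerset_topology"

text \<open>Sending \<open>x\<close> to the set of kernels that omit it collects all the characters
  into one homomorphism to the compact Boolean group of all sets of subsets of \<open>G\<close>. It
  is injective because the kernels separate points from the identity.\<close>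

lemma precompact_kernel_topology:
  assumes "group G"
    and index: "\<And>K x y. \<lbrakk>K \<in> \<K>; x \<in> carrier G; y \<in> carrier G\<rbrakk> \<Longrightarrow>
      x \<otimes>\<^bsub>G\<^esub> y \<in> K \<longleftrightarrow> (x \<in> K \<longleftrightarrow> y \<in> K)"
    and separating: "\<And>x. \<lbrakk>x \<in> carrier G; x \<noteq> \<one>\<^bsub>G\<^esub>\<rbrakk> \<Longrightarrow> \<exists>K\<in>\<K>. x \<notin> K"
  shows "precompact_group G (kernel_topology G \<K>)"
  unfolding kernel_topology_def
proof (rule precompact_group_pullback[OF topological_group_powerset compact_space_powerset])
  interpret group G by fact
  show "(\<lambda>x. {K \<in> \<K>. x \<notin> K}) \<in> hom G (sym_diff_group UNIV)"
    by (auto simp: hom_def index)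
  show "inj_on (\<lambda>x. {K \<in> \<K>. x \<notin> K}) (carrier G)"
  proof (rule inj_onI)
    fix x y assume x: "x \<in> carrier G" and y: "y \<in> carrier G"
      and "{K \<in> \<K>. x \<notin> K} = {K \<in> \<K>. y \<notin> K}"
    then have eq: "x \<in> K \<longleftrightarrow> y \<in> K" if "K \<in> \<K>" for K
      using that by (auto simp: set_eq_iff)
    \<comment> \<open>Applied to the identity twice, \<open>index\<close> shows that the identity
      lies in \<open>K\<close>. Applied to \<open>y\<close> and its inverse, it then shows that both
      have the same value, which is also the value of \<open>x\<close>.\<close>
    have "x \<otimes>\<^bsub>G\<^esub> inv\<^bsub>G\<^esub> y \<in> K" if "K \<in> \<K>" for K
      using index[OF that x inv_closed[OF y]] index[OF that y inv_closed[OF y]]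
        index[OF that one_closed one_closed] eq[OF that] y by simp
    then have "x \<otimes>\<^bsub>G\<^esub> inv\<^bsub>G\<^esub> y = \<one>\<^bsub>G\<^esub>"
      using separating[of "x \<otimes>\<^bsub>G\<^esub> inv\<^bsub>G\<^esub> y"] x y by auto
    then show "x = y"
      using x y inv_equality[of x "inv\<^bsub>G\<^esub> y"] by simp
  qed
qed fact

lemma openin_kernel_topology:
  assumes "K \<in> \<K>"
  shows "openin (kernel_topology G \<K>) (carrier G \<inter> K)"
  unfolding kernel_topology_def openin_pullback_topology
  using openin_powerset_mem(2)[of K] assms by (intro exI[of _ "{X. K \<notin> X}"]) auto

lemma identity_nbhd_kernel_topology:
  assumes "identity_nbhd G (kernel_topology G \<K>) U"
    and one: "\<And>K. K \<in> \<K> \<Longrightarrow> \<one>\<^bsub>G\<^esub> \<in> K"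
  obtains \<A> where "finite \<A>" "\<A> \<subseteq> \<K>" "carrier G \<inter> \<Inter>\<A> \<subseteq> U"
proof -
  obtain W where "openin powerset_topology W" "{K \<in> \<K>. \<one>\<^bsub>G\<^esub> \<notin> K} \<in> W"
    and U: "{x \<in> carrier G. {K \<in> \<K>. x \<notin> K} \<in> W} \<subseteq> U"
    using assms(1) unfolding identity_nbhd_def kernel_topology_def openin_pullback_topology
    by blast
  moreover have "{K \<in> \<K>. \<one>\<^bsub>G\<^esub> \<notin> K} = {}" using one by blast
  ultimately obtain A where A: "finite A" "\<And>Y. Y \<inter> A = {} \<Longrightarrow> Y \<in> W"
    by (auto elim!: openin_powerset_finite)
  show thesis
  proof (rule that[of "A \<inter> \<K>"])
    show "carrier G \<inter> \<Inter>(A \<inter> \<K>) \<subseteq> U"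
    proof
      fix x assume "x \<in> carrier G \<inter> \<Inter>(A \<inter> \<K>)"
      moreover from this have "{K \<in> \<K>. x \<notin> K} \<in> W" by (intro A(2)) blast
      ultimately show "x \<in> U" using U by blast
    qed
  qed (use A in auto)
qed

section \<open>Rational cuts and successor cardinals\<close>

text \<open>A rational between the least value of \<open>h\<close> on \<open>F\<close> and all the
  other values cuts off exactly one point, and one is odd.\<close>

lemma odd_card_initial_segment:
  fixes h :: "'b \<Rightarrow> real"
  assumes "finite F" "F \<noteq> {}" "inj_on h F"
  shows "\<exists>q :: rat. odd (card {b \<in> F. h b < of_rat q})"
proof -
  define b where "b = arg_min_on h F"
  have b: "b \<in> F" "\<And>c. c \<in> F \<Longrightarrow> h b \<le> h c"
    using assms(1,2) by (simp_all add: b_def arg_min_if_finite arg_min_least)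
  have less: "h b < h c" if "c \<in> F - {b}" for c
    using b(2)[of c] that inj_onD[OF assms(3), of b c] b(1) by fastforce
  obtain y where y: "h b < y" "\<And>c. c \<in> F - {b} \<Longrightarrow> y \<le> h c"
  proof (cases "F - {b} = {}")
    case True
    then show thesis by (intro that[of "h b + 1"]) auto
  next
    case False
    then show thesis
      using assms(1) less by (intro that[of "Min (h ` (F - {b}))"]) auto
  qed
  obtain q where "h b < of_rat q" "of_rat q < y" using of_rat_dense[OF y(1)] by blast
  then have "{c \<in> F. h c < of_rat q} = {b}" using b(1) y(2) by force
  then show ?thesis by (intro exI[of _ q]) simp
qed

text \<open>This is the regularity of an infinite successor cardinal: the segments
  \<open>under ?r a\<close> form a chain covering \<open>B\<close>, and a set of size at most
  \<open>|A|\<close> covered by such a chain lies in one of its members.\<close>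

lemma bounded_in_cardSuc:
  assumes A: "infinite A" and B: "B \<subseteq> Field (cardSuc |A| )" "|B| \<le>o |A|"
  shows "\<exists>a \<in> Field (cardSuc |A| ). \<forall>b\<in>B. (b, a) \<in> cardSuc |A|"
proof -
  let ?r = "cardSuc |A|"
  have wo: "Well_order ?r"
    by (simp add: card_of_Card_order cardSuc_Card_order card_order_on_well_order_on)
  then have "trans ?r" "Refl ?r"
    by (auto simp: well_order_on_def linear_order_on_def partial_order_on_def preorder_on_def)
  then have "relChain ?r (under ?r)" "B \<subseteq> (\<Union>a\<in>Field ?r. under ?r a)"
    using B(1) by (auto simp: relChain_def under_def refl_on_def dest: transD)
  moreover have "Cinfinite |A|"
    using A by (simp add: cinfinite_def card_of_card_order_on Field_card_of)
  ultimately obtain a where "a \<in> Field ?r" "B \<subseteq> under ?r a"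
    using B(2) cardSuc_UNION_Cinfinite by blast
  then show ?thesis by (auto simp: under_def)
qed

text \<open>A proper initial segment of a cardinal is smaller than that cardinal, and below the
  successor of \<open>|A|\<close> this means at most \<open>|A|\<close>.\<close>

lemma embedding_underS_cardSuc:
  assumes "a \<in> Field (cardSuc |A| )"
  shows "\<exists>h. inj_on h (underS (cardSuc |A| ) a) \<and> h ` underS (cardSuc |A| ) a \<subseteq> A"
proof -
  have "|underS (cardSuc |A| ) a| <o cardSuc |A|"
    using assms by (simp add: card_of_underS card_of_Card_order cardSuc_Card_order)
  then have "|underS (cardSuc |A| ) a| \<le>o |A|"
    by (rule cardSuc_ordLeq_ordLess[OF card_of_Card_order card_of_Card_order, THEN iffD1])
  then show ?thesis by (simp add: card_of_ordLeq[symmetric])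
qed

lemma continuum_ordLeq_real: "|Field continuum| \<le>o |UNIV :: real set|"
proof -
  have "|Field continuum| \<le>o |UNIV :: (nat \<Rightarrow> bool) set|"
    by (rule card_of_mono1) simp
  also have "|UNIV :: (nat \<Rightarrow> bool) set| \<le>o |UNIV :: nat set set|"
    by (rule card_of_ordLeqI[of Collect]) (auto intro: injI)
  also have "|UNIV :: nat set set| =o |UNIV :: real set|"
    using nat_sets_eqpoll_reals by (simp add: eqpoll_iff_card_of_ordIso)
  finally show ?thesis .
qed

lemma natLeq_ordLeq_real: "natLeq \<le>o |UNIV :: real set|"
  using infinite_UNIV_char_0 infinite_iff_natLeq_ordLeq by blast


section \<open>The group of finite subsets of the successor cardinal\<close>

definition parity_kernel :: "'a set \<Rightarrow> 'a set \<Rightarrow> 'a set set" where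
  "parity_kernel I P = {F \<in> Fpow I. even (card (F \<inter> P))}"

text \<open>Intersection with \<open>P\<close> distributes over symmetric difference, so the parity
  of \<open>F \<inter> P\<close> is a character of the Boolean group \<open>Fpow I\<close>. This
  provides the hypothesis \<open>index\<close> of \<open>precompact_kernel_topology\<close>.\<close>

lemma sym_diff_in_parity_kernel:
  assumes "X \<in> Fpow I" "Y \<in> Fpow I"
  shows "sym_diff X Y \<in> parity_kernel I P \<longleftrightarrow> (X \<in> parity_kernel I P \<longleftrightarrow> Y \<in> parity_kernel I P)"
proof -
  have "sym_diff X Y \<inter> P = sym_diff (X \<inter> P) (Y \<inter> P)" by blast
  then have "even (card (sym_diff X Y \<inter> P)) \<longleftrightarrow> (even (card (X \<inter> P)) \<longleftrightarrow> even (card (Y \<inter> P)))"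
    using assms by (simp add: even_card_sym_diff Fpow_def)
  then show ?thesis
    using assms by (auto simp: parity_kernel_def Fpow_def)
qed

theorem corollary2p4:
  shows "\<exists>(G :: real set set monoid) (T :: real set set topology).
           topological_group G T \<and> comm_group G \<and> precompact_group G T \<and>
           pseudo_fine continuum G T \<and> natLeq <o pseudocharacter G T"
proof -
  \<comment> \<open>The points of this well-order are sets of reals, so group elements, being finite
    sets of points, have type \<open>real set set\<close>.\<close>
  define r where "r = cardSuc |UNIV :: real set|"
  let ?I = "Field r"
  have card: "Card_order r"
    by (simp add: r_def card_of_Card_order cardSuc_Card_order)
  then have wo: "Well_order r" by (rule card_order_on_well_order_on)
  then have trans: "trans r" and refl: "Refl r" and antisym: "antisym r"
    by (auto simp: well_order_on_def linear_order_on_def partial_order_on_def preorder_on_def)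
  have bounded: "\<exists>a\<in>?I. \<forall>b\<in>B. (b, a) \<in> r" if "B \<subseteq> ?I" "|B| \<le>o |UNIV :: real set|" for B
    using bounded_in_cardSuc[OF infinite_UNIV_char_0] that unfolding r_def by blast
  have "infinite ?I"
    by (simp add: r_def card_of_cardSuc_finite infinite_UNIV_char_0)
  \<comment> \<open>An infinite cardinal is a limit, so each point lies strictly below another one.
    This is what makes the kernels separate points.\<close>
  then have no_max: "\<exists>a\<in>?I. b \<in> underS r a" if "b \<in> ?I" for b
    using infinite_Card_order_limit[OF card _ that] by (auto simp: underS_def)
  have "\<exists>h :: real set \<Rightarrow> real. inj_on h (underS r a)" if "a \<in> ?I" for a
    using embedding_underS_cardSuc[of a "UNIV :: real set"] that unfolding r_def by blast
  then obtain h :: "real set \<Rightarrow> real set \<Rightarrow> real"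
    where h: "\<And>a. a \<in> ?I \<Longrightarrow> inj_on (h a) (underS r a)" by metis

  define ker where "ker a q = parity_kernel ?I {b \<in> underS r a. h a b < of_rat q}" for a and q :: rat
  \<comment> \<open>These are the subgroups \<open>G\<^sub>a\<close>. They avoid everything strictly
    below \<open>a\<close>, and they shrink as \<open>a\<close> grows.\<close>
  define below where "below a = {F \<in> Fpow ?I. F \<inter> underS r a = {}}" for a
  define \<K> where "\<K> = {ker a q | a q. a \<in> ?I}"
  define G where "G = sym_diff_group (Fpow ?I)"
  define T where "T = kernel_topology G \<K>"
  have carrier: "carrier G = Fpow ?I" and one: "\<one>\<^bsub>G\<^esub> = {}" by (simp_all add: G_def)

  \<comment> \<open>A set with no point below \<open>b\<close> has none below an earlier
    \<open>a\<close>, so the character counts zero points.\<close>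
  have below_ker: "below b \<subseteq> ker a q" if "(a, b) \<in> r" for a b q
  proof -
    have "underS r a \<subseteq> underS r b"
      using that trans antisym by (auto simp: underS_def dest: transD antisymD)
    then have "F \<inter> {c \<in> underS r a. h a c < of_rat q} = {}" if "F \<inter> underS r b = {}" for F
      using that by blast
    then show ?thesis by (auto simp: ker_def below_def parity_kernel_def)
  qed
  \<comment> \<open>If \<open>F\<close> had points below \<open>a\<close>, some rational cut would
    count an odd number of them.\<close>
  have ker_below: "(\<Inter>q. ker a q) \<subseteq> below a" if a: "a \<in> ?I" for a
  proof
    fix F assume F: "F \<in> (\<Inter>q. ker a q)"
    then have "F \<in> Fpow ?I" by (auto simp: ker_def parity_kernel_def)
    moreover have "F \<inter> underS r a = {}"
    proof (rule ccontr)
      assume "F \<inter> underS r a \<noteq> {}"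
      moreover have "finite (F \<inter> underS r a)" "inj_on (h a) (F \<inter> underS r a)"
        using \<open>F \<in> Fpow ?I\<close> h[OF a] by (auto simp: Fpow_def intro: inj_on_subset)
      ultimately obtain q :: rat
        where "odd (card {b \<in> F \<inter> underS r a. h a b < of_rat q})"
        using odd_card_initial_segment by blast
      moreover have "{b \<in> F \<inter> underS r a. h a b < of_rat q} =
          F \<inter> {b \<in> underS r a. h a b < of_rat q}" by blast
      ultimately have "F \<notin> ker a q" by (simp add: ker_def parity_kernel_def)
      then show False using F by blast
    qed
    ultimately show "F \<in> below a" by (simp add: below_def)
  qed
  have one_ker: "\<one>\<^bsub>G\<^esub> \<in> K" if "K \<in> \<K>" for K
    using that by (auto simp: \<K>_def ker_def one parity_kernel_def Fpow_def)

  have comm: "comm_group G"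
    unfolding G_def by (rule comm_group_sym_diff_group) (auto simp: Fpow_def)
  have precompact: "precompact_group G T"
    unfolding T_def
  proof (rule precompact_kernel_topology)
    show "group G" using comm by (rule comm_group.axioms)
    show "x \<otimes>\<^bsub>G\<^esub> y \<in> K \<longleftrightarrow> (x \<in> K \<longleftrightarrow> y \<in> K)"
      if "K \<in> \<K>" "x \<in> carrier G" "y \<in> carrier G" for K x y
      using that sym_diff_in_parity_kernel[of x ?I y] by (auto simp: \<K>_def ker_def G_def)
    show "\<exists>K\<in>\<K>. F \<notin> K" if "F \<in> carrier G" "F \<noteq> \<one>\<^bsub>G\<^esub>" for F
    proof -
      from that obtain b where b: "b \<in> F" "b \<in> ?I"
        by (auto simp: carrier one Fpow_def)
      then obtain a where a: "a \<in> ?I" "b \<in> underS r a" using no_max by blast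
      then have "F \<notin> below a" using b by (auto simp: below_def)
      then obtain q where "F \<notin> ker a q" using ker_below[OF a(1)] by blast
      then show ?thesis using a(1) by (auto simp: \<K>_def)
    qed
  qed
  then have topological: "topological_group G T" by (simp add: precompact_group_def)

  \<comment> \<open>A neighbourhood contains the intersection of finitely many kernels, and a single
    \<open>a\<close> bounds all their indices.\<close>
  have nbhd_below: "\<exists>a\<in>?I. below a \<subseteq> U" if U: "identity_nbhd G T U" for U
  proof -
    obtain \<A> where \<A>: "finite \<A>" "\<A> \<subseteq> \<K>" "carrier G \<inter> \<Inter>\<A> \<subseteq> U"
      by (rule identity_nbhd_kernel_topology[OF U[unfolded T_def] one_ker])
    have "\<forall>K\<in>\<A>. \<exists>a\<in>?I. \<exists>q. K = ker a q" using \<A>(2) unfolding \<K>_def by blast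
    then obtain i where i: "\<And>K. K \<in> \<A> \<Longrightarrow> i K \<in> ?I \<and> (\<exists>q. K = ker (i K) q)" by metis
    have "|i ` \<A>| <o |UNIV :: real set|"
      using \<A>(1)
      by (intro finite_ordLess_infinite)
        (simp_all add: Field_card_of infinite_UNIV_char_0 card_of_well_order_on)
    then have "|i ` \<A>| \<le>o |UNIV :: real set|" by (rule ordLess_imp_ordLeq)
    then obtain a where a: "a \<in> ?I" "\<And>K. K \<in> \<A> \<Longrightarrow> (i K, a) \<in> r"
      using bounded[of "i ` \<A>"] i by blast
    have "below a \<subseteq> K" if "K \<in> \<A>" for K
      using i[OF that] below_ker[OF a(2)[OF that]] by metis
    moreover have "below a \<subseteq> carrier G" by (auto simp: below_def carrier)
    ultimately show ?thesis using \<A>(3) a(1) by blast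
  qed
  \<comment> \<open>The index type is left arbitrary because this serves twice: for a family indexed
    by the continuum, and for a hypothetical countable pseudobase.\<close>
  have absorb: "\<exists>a\<in>?I. \<forall>j\<in>J. below a \<subseteq> U j"
    if J: "|J| \<le>o |UNIV :: real set|" and U: "\<And>j. j \<in> J \<Longrightarrow> identity_nbhd G T (U j)"
    for J :: "'j set" and U
  proof -
    obtain i where i: "\<And>j. j \<in> J \<Longrightarrow> i j \<in> ?I \<and> below (i j) \<subseteq> U j"
      using nbhd_below[OF U] by metis
    have "|i ` J| \<le>o |UNIV :: real set|"
      using card_of_image J by (rule ordLeq_transitive)
    then obtain a where a: "a \<in> ?I" "\<And>j. j \<in> J \<Longrightarrow> (i j, a) \<in> r"
      using bounded[of "i ` J"] i by blast
    \<comment> \<open>The inclusion passes through the intersection of all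
      \<open>ker (i j) q\<close>.\<close>
    have "below a \<subseteq> below (i j)" if "j \<in> J" for j
      using below_ker[OF a(2)[OF that]] ker_below i[OF that] by blast
    then show ?thesis using i a(1) by blast
  qed

  have "pseudo_fine continuum G T"
    unfolding pseudo_fine_def
  proof (intro allI impI)
    fix U assume U: "\<forall>\<alpha>\<in>Field continuum. identity_nbhd G T (U \<alpha>)"
    obtain a where a: "a \<in> ?I" "\<forall>\<alpha>\<in>Field continuum. below a \<subseteq> U \<alpha>"
      using absorb[OF continuum_ordLeq_real, of U] U by blast
    \<comment> \<open>As \<open>from_nat\<close> enumerates all the rationals, the intersection of
      these open kernels lies in \<open>below a\<close>.\<close>
    let ?V = "\<lambda>n. ker a (from_nat n)"
    have "identity_nbhd G T (?V n)" for n
    proof -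
      have K: "?V n \<in> \<K>" using a(1) by (auto simp: \<K>_def)
      have "?V n \<subseteq> carrier G" by (auto simp: ker_def parity_kernel_def carrier)
      then show ?thesis
        using openin_kernel_topology[OF K, of G] one_ker[OF K]
        by (auto simp: identity_nbhd_def T_def Int_absorb1)
    qed
    moreover have "(\<Inter>n. ?V n) \<subseteq> (\<Inter>\<alpha>\<in>Field continuum. U \<alpha>)"
    proof -
      have "(\<Inter>n. ?V n) \<subseteq> ker a q" for q
        using INT_lower[of "to_nat q" UNIV ?V] by simp
      then have "(\<Inter>n. ?V n) \<subseteq> (\<Inter>q. ker a q)" by (rule INT_greatest)
      also have "\<dots> \<subseteq> below a" by (rule ker_below[OF a(1)])
      also have "\<dots> \<subseteq> (\<Inter>\<alpha>\<in>Field continuum. U \<alpha>)"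
        by (rule INT_greatest[OF a(2)[rule_format]])
      finally show ?thesis .
    qed
    ultimately show "\<exists>V :: nat \<Rightarrow> real set set set. (\<forall>n. identity_nbhd G T (V n)) \<and>
        (\<Inter>n. V n) \<subseteq> (\<Inter>\<alpha>\<in>Field continuum. U \<alpha>)"
      by (intro exI[of _ ?V]) simp
  qed
  moreover have "\<not> pseudocharacter G T \<le>o natLeq"
  proof
    assume le: "pseudocharacter G T \<le>o natLeq"
    note psi = pseudocharacter_attained[OF topological]
    obtain U where U: "identity_pseudobase G T (pseudocharacter G T) U" using psi(2) by blast
    let ?J = "Field (pseudocharacter G T)"
    have "|?J| \<le>o |UNIV :: real set|"
      using card_of_Field_ordIso[OF psi(1)] le natLeq_ordLeq_real
      by (meson ordIso_ordLeq_trans ordLeq_transitive)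
    moreover have "identity_nbhd G T (U \<alpha>)" if "\<alpha> \<in> ?J" for \<alpha>
      using U that topological openin_subset[of T "U \<alpha>"]
      by (auto simp: identity_pseudobase_def identity_nbhd_def topological_group_def)
    ultimately obtain a where a: "a \<in> ?I" "\<forall>\<alpha>\<in>?J. below a \<subseteq> U \<alpha>"
      using absorb by metis
    \<comment> \<open>The point \<open>a\<close> is not strictly below itself, so \<open>{a}\<close>
      is a nonidentity element of \<open>below a\<close> and survives in the intersection of the
      supposed pseudobase.\<close>
    have "{a} \<in> below a" using a(1) by (auto simp: below_def Fpow_def underS_def)
    then have "{a} \<in> carrier G \<inter> (\<Inter>\<alpha>\<in>?J. U \<alpha>)"
      using a(2) by (auto simp: below_def carrier)
    moreover have "carrier G \<inter> (\<Inter>\<alpha>\<in>?J. U \<alpha>) = {{}}"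
      using U by (simp add: identity_pseudobase_def one)
    ultimately have "{a} \<in> {{}}" by (rule back_subst)
    then show False by simp
  qed
  then have "natLeq <o pseudocharacter G T"
    using pseudocharacter_attained(1)[OF topological] natLeq_Well_order not_ordLeq_iff_ordLess
    by (metis card_order_on_well_order_on)
  ultimately show ?thesis
    using topological comm precompact by blast
qed


end
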